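(* Let $0<q<p\le1$, let $k$ be a positive integer and $n\ge0$. Then for all $x,y$: $$B_{n,p,q}^{(k)}(x)=\sum_{l=0}^n\sum_{m=0}^n(-1)^{n-m}m!\,S_2(n,m,x)S_2(m,l,y)C_{l,p,q}^{(k)}(y),$$ $$B_{n,p,q}^{(k)}(x)=\sum_{l=0}^n\sum_{m=0}^n(-1)^{n}m!\,S_2(n,m,x)S_2(m,l,-y)\widehat{C}_{l,p,q}^{(k)}(y),$$ $$C_{n,p,q}^{(k)}(x)=\sum_{l=0}^n\sum_{m=0}^n\frac{(-1)^{n-m}}{m!}S_1(n,m,x)S_1(m,l,y)B_{l,p,q}^{(k)}(y),$$ $$\widehat{C}_{n,p,q}^{(k)}(x)=\sum_{l=0}^n\sum_{m=0}^n\frac{(-1)^{n}}{m!}S_1(n,m,-x)S_1(m,l,y)B_{l,p,q}^{(k)}(y).$$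
   Context: $[n]_{p,q}=\frac{p^n-q^n}{p-q}$; $\mathrm{Li}_{k,p,q}(t)=\sum_{n\ge1} t^n/[n]_{p,q}^k$. The $(p,q)$-poly-Bernoulli polynomials: $\frac{\mathrm{Li}_{k,p,q}(1-e^{-t})}{1-e^{-t}}e^{-xt}=\sum_{n\ge0}B_{n,p,q}^{(k)}(x)\frac{t^n}{n!}$. For $0<q<p\le1$ the $(p,q)$-integral is $\int_0^x f(t)\,d_{p,q}t=(p-q)x\sum_{n\ge0} \frac{q^n}{p^{n+1}}f\!\left(\frac{q^n}{p^{n+1}}x\right)$. With $(y)_n=y(y-1)\cdots(y-n+1)$, $(y)_0=1$: $C_{n,p,q}^{(k)}(x)=\int_0^1\cdots\int_0^1 (t_1\cdots t_k-x)_n\,d_{p,q}t_1\cdots d_{p,q}t_k$ and $\widehat{C}_{n,p,q}^{(k)}(x)=\int_0^1\cdots\int_0^1 (-t_1\cdots t_k+x)_n\,d_{p,q}t_1\cdots d_{p,q}t_k$ ($k$-fold). Weighted Stirling numbers: $\frac{e^{xt}(e^t-1)^m}{m!}=\sum_{n\ge m}S_2(n,m,x)\frac{t^n}{n!}$ and $\frac{(1-t)^{-x}(-\ln(1-t))^m}{m!}=\sum_{n\ge m}S_1(n,m,x)\frac{t^n}{n!}$ (with $S_i(n,m,x)=0$ for $m>n$). *)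

theory Defs
  imports Complex_Main "HOL-Computational_Algebra.Formal_Power_Series"
begin

text \<open>
  Generating functions are formal power series in \<open>t\<close>, rendered by \<^term>\<open>fps_X\<close>.
  The parameters \<open>p\<close>, \<open>q\<close> are real; the arguments \<open>x\<close>, \<open>y\<close> of the polynomials range over
  any \<^class>\<open>real_normed_field\<close>, which covers both real and complex arguments.
\<close>

definition pq_bracket :: "real \<Rightarrow> real \<Rightarrow> nat \<Rightarrow> real" where
  "pq_bracket p q n = (p ^ n - q ^ n) / (p - q)"

definition pq_polylog :: "nat \<Rightarrow> real \<Rightarrow> real \<Rightarrow> 'a::real_normed_field fps" where
  "pq_polylog k p q = Abs_fps (\<lambda>n. if n = 0 then 0 else of_real (1 / pq_bracket p q n ^ k))"

definition egf_coeff :: "'a::field_char_0 fps \<Rightarrow> nat \<Rightarrow> 'a" where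
  "egf_coeff F n = fact n * fps_nth F n"

text \<open>
  The quotient below is an exact division in the ring of formal power series
  (see \<open>pq_polylog_quotient\<close>); the denominator \<open>1 - exp (-t)\<close> has order 1.
\<close>

definition pq_poly_bernoulli ::
    "nat \<Rightarrow> real \<Rightarrow> real \<Rightarrow> nat \<Rightarrow> 'a::real_normed_field \<Rightarrow> 'a" where
  "pq_poly_bernoulli k p q n x =
     egf_coeff ((pq_polylog k p q oo (1 - fps_exp (-1))) / (1 - fps_exp (-1)) * fps_exp (-x)) n"

lemma pq_polylog_quotient:
  "((pq_polylog k p q :: 'a::real_normed_field fps) oo (1 - fps_exp (-1))) / (1 - fps_exp (-1))
     * (1 - fps_exp (-1)) = pq_polylog k p q oo (1 - fps_exp (-1))"
proof -
  let ?u = "1 - fps_exp (-1) :: 'a fps"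
  let ?L = "pq_polylog k p q :: 'a fps"
  have u0: "fps_nth ?u 0 = 0" by simp
  have "?L = fps_shift 1 ?L * fps_X"
    by (rule fps_ext) (simp add: pq_polylog_def)
  then have "?L oo ?u = (fps_shift 1 ?L * fps_X) oo ?u" by simp
  also have "\<dots> = (fps_shift 1 ?L oo ?u) * ?u"
    by (simp add: fps_compose_mult_distrib[OF u0])
  finally have "?u dvd ?L oo ?u" by simp
  then show ?thesis by simp
qed

definition falling_fact :: "'a::comm_ring_1 \<Rightarrow> nat \<Rightarrow> 'a" where
  "falling_fact y n = (\<Prod>i<n. y - of_nat i)"

text \<open>\<open>pq_integral p q x f\<close> is the \<open>(p,q)\<close>-integral of \<open>f\<close> from \<open>0\<close> to \<open>x\<close>.\<close>

definition pq_integral ::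
    "real \<Rightarrow> real \<Rightarrow> real \<Rightarrow> (real \<Rightarrow> 'a::real_normed_vector) \<Rightarrow> 'a" where
  "pq_integral p q x f =
     ((p - q) * x) *\<^sub>R (\<Sum>n. (q ^ n / p ^ (n + 1)) *\<^sub>R f (q ^ n / p ^ (n + 1) * x))"

text \<open>
  The \<open>k\<close>-fold iterated integral over \<open>[0,1]\<close> of a function of \<open>[t\<^sub>1, \<dots>, t\<^sub>k]\<close>;
  the innermost integration is with respect to \<open>t\<^sub>1\<close>.
\<close>

primrec pq_integral_iter ::
    "real \<Rightarrow> real \<Rightarrow> nat \<Rightarrow> (real list \<Rightarrow> 'a::real_normed_vector) \<Rightarrow> 'a" where
  "pq_integral_iter p q 0 f = f []"
| "pq_integral_iter p q (Suc k) f =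
     pq_integral p q 1 (\<lambda>t. pq_integral_iter p q k (\<lambda>ts. f (ts @ [t])))"

definition pq_poly_cauchy ::
    "nat \<Rightarrow> real \<Rightarrow> real \<Rightarrow> nat \<Rightarrow> 'a::real_normed_field \<Rightarrow> 'a" where
  "pq_poly_cauchy k p q n x =
     pq_integral_iter p q k (\<lambda>ts. falling_fact (of_real (prod_list ts) - x) n)"

definition pq_poly_cauchy_hat ::
    "nat \<Rightarrow> real \<Rightarrow> real \<Rightarrow> nat \<Rightarrow> 'a::real_normed_field \<Rightarrow> 'a" where
  "pq_poly_cauchy_hat k p q n x =
     pq_integral_iter p q k (\<lambda>ts. falling_fact (- of_real (prod_list ts) + x) n)"

definition weighted_stirling2 :: "nat \<Rightarrow> nat \<Rightarrow> 'a::field_char_0 \<Rightarrow> 'a" where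
  "weighted_stirling2 n m x =
     egf_coeff (fps_exp x * (fps_exp 1 - 1) ^ m / fps_const (fact m)) n"

text \<open>
  The series \<^term>\<open>fps_binomial c\<close> is \<open>(1 + t)\<^sup>c\<close> and \<^term>\<open>fps_ln 1\<close> is \<open>ln (1 + t)\<close>,
  so composition with \<^term>\<open>- fps_X\<close> gives \<open>(1 - t)\<^sup>c\<close> and \<open>ln (1 - t)\<close>.
\<close>

definition weighted_stirling1 :: "nat \<Rightarrow> nat \<Rightarrow> 'a::field_char_0 \<Rightarrow> 'a" where
  "weighted_stirling1 n m x =
     egf_coeff ((fps_binomial (-x) oo (- fps_X)) * (- (fps_ln 1 oo (- fps_X))) ^ m
       / fps_const (fact m)) n"

lemma weighted_stirling2_eq_0: "n < m \<Longrightarrow> weighted_stirling2 n m x = 0"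
proof -
  assume nm: "n < m"
  have "fps_nth (fps_exp x * (fps_exp 1 - 1) ^ m) n = 0"
    using nm by (simp add: fps_mult_nth startsby_zero_power_prefix[rule_format])
  then show ?thesis by (simp add: weighted_stirling2_def egf_coeff_def fps_divide_unit fps_const_inverse)
qed

lemma weighted_stirling1_eq_0: "n < m \<Longrightarrow> weighted_stirling1 n m x = 0"
proof -
  assume nm: "n < m"
  have "fps_nth ((fps_binomial (-x) oo (- fps_X)) * (- (fps_ln 1 oo (- fps_X))) ^ m) n = 0"
    using nm by (simp add: fps_mult_nth startsby_zero_power_prefix[rule_format])
  then show ?thesis by (simp add: weighted_stirling1_def egf_coeff_def fps_divide_unit fps_const_inverse)
qed

end

theory Submission
  imports Defs
begin

text \<open>
  Put \<open>c\<^sub>m = 1 / [m+1]\<^sup>k\<close>. On the one hand \<open>c\<^sub>m\<close> is the coefficient of \<open>w\<^sup>m\<close> in \<open>Li(w) / w\<close>,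
  on the other hand it is the value of the \<open>k\<close>-fold integral at \<open>(t\<^sub>1 \<cdots> t\<^sub>k)\<^sup>m\<close>. Substituting
  \<open>w = 1 - exp (-t)\<close>, respectively integrating the expansion of \<open>(u - x)\<^sub>n\<close> in powers of \<open>u\<close>,
  expresses \<open>B\<^sub>n(x)\<close> through \<open>S\<^sub>2\<close> and \<open>C\<^sub>n(x)\<close> through \<open>S\<^sub>1\<close> in terms of the \<open>c\<^sub>m\<close>.
  Both expansions are inverted by the inverse substitutions, for an arbitrary weight \<open>y\<close>, and
  chaining an expansion of one family with an inversion of the other gives the four formulas.
\<close>

section \<open>Weighted Stirling transforms as compositions of power series\<close>

text \<open>The series \<open>G * H ^ l / fps_const (fact l)\<close> are the generating functions of
  the weighted Stirling numbers, so Stirling sums become substitutions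
  \<open>F oo H\<close>.\<close>

lemma egf_coeff_mult_compose:
  fixes F G H :: "'a::field_char_0 fps"
  assumes H0: "fps_nth H 0 = 0"
  shows "egf_coeff (G * (F oo H)) n =
           (\<Sum>l=0..n. egf_coeff (G * H ^ l / fps_const (fact l)) n * egf_coeff F l)"
proof -
  have "fps_nth (G * (F oo H)) n = (\<Sum>i=0..n. \<Sum>l=0..n - i. fps_nth G i * (fps_nth F l * fps_nth (H ^ l) (n - i)))"
    by (simp add: fps_mult_nth fps_compose_nth sum_distrib_left)
  \<comment> \<open>\<open>H ^ l\<close> has no terms below degree \<open>l\<close>, so the added
    indices \<open>l > n - i\<close> contribute nothing, and the range no longer depends on
    \<open>i\<close>.\<close>
  also have "\<dots> = (\<Sum>i=0..n. \<Sum>l=0..n. fps_nth G i * (fps_nth F l * fps_nth (H ^ l) (n - i)))"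
    using H0 by (intro sum.cong refl sum.mono_neutral_left) (auto intro: startsby_zero_power_prefix[rule_format])
  also have "\<dots> = (\<Sum>l=0..n. \<Sum>i=0..n. fps_nth G i * (fps_nth F l * fps_nth (H ^ l) (n - i)))"
    by (rule sum.swap)
  also have "\<dots> = (\<Sum>l=0..n. fps_nth (G * H ^ l) n * fps_nth F l)"
    by (simp add: fps_mult_nth sum_distrib_left mult_ac)
  finally have coeff: "fps_nth (G * (F oo H)) n = (\<Sum>l=0..n. fps_nth (G * H ^ l) n * fps_nth F l)" .
  have divide: "fps_nth (A / fps_const (fact l)) n = fps_nth A n / fact l" for A :: "'a fps" and l
    by (simp add: fps_divide_unit fps_const_inverse divide_inverse)
  show ?thesis
    unfolding egf_coeff_def coeff divide sum_distrib_left by (simp add: mult_ac)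
qed

lemma egf_coeff_compose_uminus:
  "egf_coeff (F oo (- fps_X)) n = (-1) ^ n * egf_coeff F n"
  by (simp add: egf_coeff_def fps_compose_uminus')

lemma egf_coeff_fps_exp: "egf_coeff (fps_exp u) n = u ^ n"
  by (simp add: egf_coeff_def)

lemma egf_coeff_fps_binomial: "egf_coeff (fps_binomial u) n = falling_fact u n"
  by (simp add: egf_coeff_def falling_fact_def gbinomial_prod_rev atLeast0LessThan)

lemma weighted_stirling2_transform:
  "(\<Sum>l=0..n. weighted_stirling2 n l x * egf_coeff F l) =
     egf_coeff (fps_exp x * (F oo (fps_exp 1 - 1))) n"
  by (subst egf_coeff_mult_compose) (simp_all add: weighted_stirling2_def)

lemma weighted_stirling1_transform:
  "(\<Sum>l=0..n. weighted_stirling1 n l x * egf_coeff F l) =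
     egf_coeff ((fps_binomial (-x) oo (- fps_X)) * (F oo (- (fps_ln 1 oo (- fps_X))))) n"
  by (subst egf_coeff_mult_compose) (simp_all add: weighted_stirling1_def)

text \<open>Both sides solve \<open>(1 + t) F' = c F\<close> with constant term 1, which determines
  the series.\<close>

lemma fps_exp_compose_fps_ln: "fps_exp c oo fps_ln 1 = fps_binomial (c::'a::field_char_0)"
proof -
  have "fps_deriv (fps_exp c oo fps_ln 1) = fps_const c * (fps_exp c oo fps_ln 1) / (1 + fps_X)"
    by (simp add: fps_compose_deriv fps_ln_deriv fps_compose_mult_distrib fps_divide_unit)
  then show ?thesis
    by (subst fps_binomial_ODE_unique'[symmetric]) simp
qed

lemma fps_binomial_compose_fps_exp_minus_1:
  "fps_binomial c oo (fps_exp 1 - 1) = fps_exp (c::'a::field_char_0)"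
proof -
  have "fps_binomial c oo (fps_exp 1 - 1) = fps_exp c oo (fps_ln 1 oo (fps_exp 1 - 1))"
    by (simp add: fps_exp_compose_fps_ln[symmetric] fps_compose_assoc)
  also have "fps_ln (1::'a) oo (fps_exp 1 - 1) = fps_X"
    by (simp add: fps_ln_fps_exp_inv fps_inv)
  finally show ?thesis by simp
qed

text \<open>The outer minus sign passes into the exponential, leaving
  \<open>exp (-c ln (1 - t))\<close>.\<close>

lemma fps_exp_compose_neg_ln:
  "fps_exp c oo (- (fps_ln 1 oo (- fps_X))) = fps_binomial (- c) oo (- fps_X :: 'a::field_char_0 fps)"
proof -
  have "- (fps_ln 1 oo (- fps_X)) = - fps_X oo (fps_ln 1 oo (- fps_X :: 'a fps))"
    by (simp add: fps_compose_uminus)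
  then have "fps_exp c oo (- (fps_ln 1 oo (- fps_X))) =
      (fps_exp c oo (- fps_X)) oo (fps_ln 1 oo (- fps_X))"
    by (simp add: fps_compose_assoc)
  also have "\<dots> = fps_exp (- c) oo fps_ln 1 oo (- fps_X)"
    by (simp add: fps_compose_assoc)
  finally show ?thesis by (simp add: fps_exp_compose_fps_ln)
qed

text \<open>Compare coefficients in \<open>exp (u t) = exp (y t) (1 + (exp t - 1))^(u - y)\<close>;
  the left side does not depend on \<open>y\<close>, so the weight is arbitrary.\<close>

lemma power_eq_sum_weighted_stirling2_falling_fact:
  fixes u y :: "'a::field_char_0"
  shows "u ^ n = (\<Sum>l=0..n. weighted_stirling2 n l y * falling_fact (u - y) l)"
  unfolding egf_coeff_fps_binomial[symmetric] weighted_stirling2_transform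
  by (simp add: fps_binomial_compose_fps_exp_minus_1 fps_exp_add_mult[symmetric] egf_coeff_fps_exp)

text \<open>Compare coefficients in \<open>(1 - t)^(u - x) = (1 - t)^(-x) exp (-u s)\<close> with
  \<open>s = -ln (1 - t)\<close>. The arguments \<open>-t\<close> and \<open>-u\<close> produce the
  signs \<open>(-1)^n\<close> and \<open>(-1)^m\<close>.\<close>

lemma falling_fact_eq_sum_weighted_stirling1:
  fixes u x :: "'a::field_char_0"
  shows "falling_fact (u - x) n = (\<Sum>m=0..n. (-1) ^ (n - m) * weighted_stirling1 n m x * u ^ m)"
proof -
  have "(\<Sum>m=0..n. weighted_stirling1 n m x * (- u) ^ m) =
      egf_coeff ((fps_binomial (- x) oo (- fps_X)) * (fps_binomial u oo (- fps_X))) n"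
    unfolding egf_coeff_fps_exp[symmetric] weighted_stirling1_transform
    by (simp add: fps_exp_compose_neg_ln)
  also have "\<dots> = egf_coeff (fps_binomial (u - x) oo (- fps_X)) n"
    by (simp add: fps_compose_mult_distrib[symmetric] fps_binomial_add_mult[symmetric])
  also have "\<dots> = (-1) ^ n * falling_fact (u - x) n"
    by (simp add: egf_coeff_compose_uminus egf_coeff_fps_binomial)
  finally have "falling_fact (u - x) n = (-1) ^ n * (\<Sum>m=0..n. weighted_stirling1 n m x * (- u) ^ m)"
    by (simp add: mult.assoc[symmetric] power_mult_distrib[symmetric])
  also have "\<dots> = (\<Sum>m=0..n. (-1) ^ (n - m) * weighted_stirling1 n m x * u ^ m)"
    unfolding sum_distrib_left
  proof (rule sum.cong[OF refl])
    fix m assume "m \<in> {0..n}"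
    then have "(-1) ^ (n - m) = (-1) ^ n * (-1 :: 'a) ^ m"
      by (simp add: minus_one_power_iff)
    moreover have "(- u) ^ m = (-1) ^ m * u ^ m"
      by (rule power_minus)
    ultimately show "(-1) ^ n * (weighted_stirling1 n m x * (- u) ^ m) =
        (-1) ^ (n - m) * weighted_stirling1 n m x * u ^ m"
      by simp
  qed
  finally show ?thesis .
qed

lemma falling_fact_uminus_eq_sum_weighted_stirling1:
  fixes u x :: "'a::field_char_0"
  shows "falling_fact (- u + x) n = (\<Sum>m=0..n. (-1) ^ n * weighted_stirling1 n m (-x) * u ^ m)"
proof -
  have "falling_fact (- u - (- x)) n =
      (\<Sum>m=0..n. (-1) ^ (n - m) * weighted_stirling1 n m (-x) * (- u) ^ m)"
    by (rule falling_fact_eq_sum_weighted_stirling1)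
  also have "\<dots> = (\<Sum>m=0..n. (-1) ^ n * weighted_stirling1 n m (-x) * u ^ m)"
  proof (rule sum.cong[OF refl])
    fix m assume "m \<in> {0..n}"
    then have "(-1 :: 'a) ^ n = (-1) ^ (n - m) * (-1) ^ m"
      by (simp add: power_add[symmetric])
    then show "(-1) ^ (n - m) * weighted_stirling1 n m (-x) * (- u) ^ m =
        (-1) ^ n * weighted_stirling1 n m (-x) * u ^ m"
      by (simp add: power_minus[of u m])
  qed
  finally show ?thesis by simp
qed

section \<open>Moments of the iterated integral\<close>

definition pq_moment :: "nat \<Rightarrow> real \<Rightarrow> real \<Rightarrow> nat \<Rightarrow> 'a::real_normed_field" where
  "pq_moment k p q m = of_real (1 / pq_bracket p q (Suc m) ^ k)"

text \<open>On \<open>t^m\<close> the integral is a geometric series of ratio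
  \<open>(q/p)^(m+1) < 1\<close>. Whole polynomials are treated at once because the infinite sum in
  \<open>pq_integral\<close> may be split only along convergent series.\<close>

lemma pq_integral_sum_power:
  fixes a :: "nat \<Rightarrow> 'a::real_normed_field"
  assumes "0 < q" "q < p"
  shows "pq_integral p q 1 (\<lambda>t. \<Sum>m=0..N. a m * of_real t ^ m) =
           (\<Sum>m=0..N. a m * pq_moment 1 p q m)"
proof -
  have monomial: "(\<lambda>n. (q ^ n / p ^ (n + 1)) * (q ^ n / p ^ (n + 1)) ^ m) sums
      (1 / (p ^ Suc m - q ^ Suc m))" for m
  proof -
    have lt: "(q / p) ^ Suc m < 1" "0 \<le> (q / p) ^ Suc m"
      using assms power_less_one_iff[of "q / p" "Suc m"] by (simp_all del: power_Suc)
    have "(\<lambda>n. (1 / p ^ Suc m) * ((q / p) ^ Suc m) ^ n) sums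
        ((1 / p ^ Suc m) * (1 / (1 - (q / p) ^ Suc m)))"
      using lt by (intro sums_mult geometric_sums) (simp del: power_Suc)
    moreover have "(1 / p ^ Suc m) * ((q / p) ^ Suc m) ^ n =
        (q ^ n / p ^ (n + 1)) * (q ^ n / p ^ (n + 1)) ^ m" for n
    proof -
      \<comment> \<open>The weight of each node equals the node itself, so the term is the node to
        the power \<open>m + 1\<close>.\<close>
      have "(q ^ n / p ^ (n + 1)) * (q ^ n / p ^ (n + 1)) ^ m = ((1 / p) * (q / p) ^ n) ^ Suc m"
        by (simp add: power_divide)
      also have "\<dots> = (1 / p ^ Suc m) * ((q / p) ^ Suc m) ^ n"
        by (simp only: power_mult_distrib power_one_over power_mult[symmetric] mult.commute[of n])
      finally show ?thesis by simp
    qed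
    moreover have "(1 / p ^ Suc m) * (1 / (1 - (q / p) ^ Suc m)) = 1 / (p ^ Suc m - q ^ Suc m)"
      using assms by (simp add: power_divide right_diff_distrib del: power_Suc)
    ultimately show ?thesis by simp
  qed
  have "(\<lambda>n. (q ^ n / p ^ (n + 1)) *\<^sub>R (\<Sum>m=0..N. a m * of_real (q ^ n / p ^ (n + 1) * 1) ^ m)) sums
      (\<Sum>m=0..N. a m * of_real (1 / (p ^ Suc m - q ^ Suc m)))"
  proof -
    have "(\<lambda>n. \<Sum>m=0..N. a m * of_real ((q ^ n / p ^ (n + 1)) * (q ^ n / p ^ (n + 1)) ^ m)) sums
        (\<Sum>m=0..N. a m * of_real (1 / (p ^ Suc m - q ^ Suc m)))"
      by (intro sums_sum sums_mult sums_of_real monomial)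
    then show ?thesis
      by (simp add: scaleR_conv_of_real sum_distrib_left mult_ac)
  qed
  then have "pq_integral p q 1 (\<lambda>t. \<Sum>m=0..N. a m * of_real t ^ m) =
      (p - q) *\<^sub>R (\<Sum>m=0..N. a m * of_real (1 / (p ^ Suc m - q ^ Suc m)))"
    unfolding pq_integral_def by (simp add: sums_unique[symmetric])
  also have "\<dots> = (\<Sum>m=0..N. a m * pq_moment 1 p q m)"
    by (simp add: scaleR_conv_of_real sum_distrib_left pq_moment_def pq_bracket_def mult_ac
        del: power_Suc)
  finally show ?thesis .
qed

text \<open>For a fixed outermost variable \<open>t\<close> the factor \<open>t^m\<close> is
  absorbed into the coefficient \<open>a m\<close>; hence the induction is over arbitrary
  \<open>a\<close>.\<close>

lemma pq_integral_iter_sum_power: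
  fixes a :: "nat \<Rightarrow> 'a::real_normed_field"
  assumes "0 < q" "q < p"
  shows "pq_integral_iter p q k (\<lambda>ts. \<Sum>m=0..N. a m * of_real (prod_list ts) ^ m) =
           (\<Sum>m=0..N. a m * pq_moment k p q m)"
proof (induction k arbitrary: a)
  case 0
  show ?case by (simp add: pq_moment_def)
next
  case (Suc k)
  have "pq_integral_iter p q k (\<lambda>ts. \<Sum>m=0..N. a m * of_real (prod_list (ts @ [t])) ^ m) =
      (\<Sum>m=0..N. (a m * pq_moment k p q m) * of_real t ^ m)" for t
    using Suc.IH[of "\<lambda>m. a m * of_real t ^ m"] by (simp add: power_mult_distrib mult_ac)
  then have "pq_integral_iter p q (Suc k) (\<lambda>ts. \<Sum>m=0..N. a m * of_real (prod_list ts) ^ m) =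
      (\<Sum>m=0..N. a m * pq_moment k p q m * pq_moment 1 p q m)"
    by (simp only: pq_integral_iter.simps pq_integral_sum_power[OF assms])
  then show ?case
    by (simp add: pq_moment_def mult.commute)
qed

section \<open>The Cauchy and Bernoulli families in terms of the moments\<close>

lemma pq_poly_cauchy_eq_sum_moment:
  fixes x :: "'a::real_normed_field"
  assumes "0 < q" "q < p"
  shows "pq_poly_cauchy k p q n x =
           (\<Sum>m=0..n. (-1) ^ (n - m) * weighted_stirling1 n m x * pq_moment k p q m)"
  unfolding pq_poly_cauchy_def falling_fact_eq_sum_weighted_stirling1
  by (rule pq_integral_iter_sum_power[OF assms])

lemma pq_poly_cauchy_hat_eq_sum_moment:
  fixes x :: "'a::real_normed_field"
  assumes "0 < q" "q < p"
  shows "pq_poly_cauchy_hat k p q n x =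
           (\<Sum>m=0..n. (-1) ^ n * weighted_stirling1 n m (-x) * pq_moment k p q m)"
  unfolding pq_poly_cauchy_hat_def falling_fact_uminus_eq_sum_weighted_stirling1
  by (rule pq_integral_iter_sum_power[OF assms])

text \<open>Justifies moving a finite Stirling sum inside the integral. Linearity is obtained only
  for polynomial integrands, where both sides reduce to the same sum of moments.\<close>

lemma pq_integral_iter_linear:
  fixes A :: "nat \<Rightarrow> nat \<Rightarrow> 'a::real_normed_field"
  assumes "0 < q" "q < p"
    and P: "\<And>l u. P l u = (\<Sum>j=0..l. A l j * u ^ j)"
  shows "(\<Sum>l=0..m. b l * pq_integral_iter p q k (\<lambda>ts. P l (of_real (prod_list ts)))) =
           pq_integral_iter p q k (\<lambda>ts. \<Sum>l=0..m. b l * P l (of_real (prod_list ts)))"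
proof -
  \<comment> \<open>Padding with zeros writes every \<open>P l\<close> with \<open>l \<le> m\<close>
    over the common degree bound \<open>m\<close>.\<close>
  define A' where "A' l j = (if j \<le> l then A l j else 0)" for l j
  have P': "P l u = (\<Sum>j=0..m. A' l j * u ^ j)" if "l \<le> m" for l u
    unfolding P A'_def using that by (intro sum.mono_neutral_cong_left) auto
  have "(\<Sum>l=0..m. b l * P l u) = (\<Sum>j=0..m. (\<Sum>l=0..m. b l * A' l j) * u ^ j)" for u
  proof -
    have "(\<Sum>l=0..m. b l * P l u) = (\<Sum>l=0..m. \<Sum>j=0..m. b l * A' l j * u ^ j)"
      by (intro sum.cong refl) (simp add: P' sum_distrib_left mult.assoc)
    then show ?thesis
      by (subst (asm) sum.swap) (simp add: sum_distrib_right)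
  qed
  then have "pq_integral_iter p q k (\<lambda>ts. \<Sum>l=0..m. b l * P l (of_real (prod_list ts))) =
      (\<Sum>j=0..m. (\<Sum>l=0..m. b l * A' l j) * pq_moment k p q j)"
    by (simp only: pq_integral_iter_sum_power[OF assms(1,2)])
  also have "\<dots> = (\<Sum>l=0..m. \<Sum>j=0..m. b l * A' l j * pq_moment k p q j)"
    unfolding sum_distrib_right by (rule sum.swap)
  also have "\<dots> = (\<Sum>l=0..m. b l * pq_integral_iter p q k (\<lambda>ts. P l (of_real (prod_list ts))))"
    by (intro sum.cong refl)
      (simp add: P' pq_integral_iter_sum_power[OF assms(1,2)] sum_distrib_left mult.assoc)
  finally show ?thesis ..
qed

lemma pq_integral_iter_power:
  fixes c :: "'a::real_normed_field"
  assumes "0 < q" "q < p"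
  shows "pq_integral_iter p q k (\<lambda>ts. c * of_real (prod_list ts) ^ m) = c * pq_moment k p q m"
proof -
  have "(\<Sum>j=0..m. (if j = m then c else 0) * f j) = c * f m" for f :: "nat \<Rightarrow> 'a"
    by (simp add: if_distrib[of "\<lambda>z. z * _"] cong: if_cong)
  then show ?thesis
    using pq_integral_iter_sum_power[OF assms, of k "\<lambda>j. if j = m then c else 0" m] by simp
qed

text \<open>Integrate the expansion of \<open>u^m\<close> in the
  \<open>falling_fact (u - y) l\<close> at the product \<open>u\<close> of the integration
  variables.\<close>

lemma pq_moment_eq_sum_cauchy:
  fixes y :: "'a::real_normed_field"
  assumes "0 < q" "q < p"
  shows "pq_moment k p q m = (\<Sum>l=0..m. weighted_stirling2 m l y * pq_poly_cauchy k p q l y)"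
proof -
  have "(\<Sum>l=0..m. weighted_stirling2 m l y * pq_poly_cauchy k p q l y) =
      pq_integral_iter p q k (\<lambda>ts. of_real (prod_list ts) ^ m)"
    unfolding pq_poly_cauchy_def power_eq_sum_weighted_stirling2_falling_fact[of _ m y]
    by (rule pq_integral_iter_linear[OF assms falling_fact_eq_sum_weighted_stirling1])
  then show ?thesis
    using pq_integral_iter_power[OF assms, of k "1 :: 'a" m] by simp
qed

text \<open>Here the power expansion is used at \<open>-u\<close> with weight \<open>-y\<close>; the
  sign \<open>(-1)^m\<close> comes from \<open>(-u)^m\<close>.\<close>

lemma pq_moment_eq_sum_cauchy_hat:
  fixes y :: "'a::real_normed_field"
  assumes "0 < q" "q < p"
  shows "(-1) ^ m * pq_moment k p q m =
           (\<Sum>l=0..m. weighted_stirling2 m l (-y) * pq_poly_cauchy_hat k p q l y)"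
proof -
  have power: "(-1) ^ m * u ^ m = (\<Sum>l=0..m. weighted_stirling2 m l (-y) * falling_fact (- u + y) l)"
    for u :: 'a
    using power_eq_sum_weighted_stirling2_falling_fact[of "- u" m "- y"] by (simp add: power_minus[of u])
  have "(\<Sum>l=0..m. weighted_stirling2 m l (-y) * pq_poly_cauchy_hat k p q l y) =
      pq_integral_iter p q k (\<lambda>ts. (-1) ^ m * of_real (prod_list ts) ^ m)"
    unfolding pq_poly_cauchy_hat_def power
    by (rule pq_integral_iter_linear[OF assms falling_fact_uminus_eq_sum_weighted_stirling1])
  then show ?thesis
    by (simp add: pq_integral_iter_power[OF assms])
qed

lemma pq_polylog_compose_divide:
  fixes w :: "'a::real_normed_field fps"
  assumes "fps_nth w 0 = 0" "w \<noteq> 0"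
  shows "(pq_polylog k p q oo w) / w = Abs_fps (pq_moment k p q) oo w"
proof -
  have "pq_polylog k p q = Abs_fps (pq_moment k p q) * (fps_X :: 'a fps)"
    by (rule fps_ext) (simp add: pq_polylog_def pq_moment_def)
  then have "pq_polylog k p q oo w = (Abs_fps (pq_moment k p q) oo w) * w"
    using assms by (simp add: fps_compose_mult_distrib)
  then show ?thesis using assms by simp
qed

lemma pq_poly_bernoulli_eq_egf_coeff:
  "pq_poly_bernoulli k p q n x =
     egf_coeff ((Abs_fps (pq_moment k p q) oo (1 - fps_exp (-1))) * fps_exp (-x)) n"
proof -
  have "fps_nth (1 - fps_exp (-1) :: 'a fps) 1 \<noteq> 0"
    by simp
  then have "(1 - fps_exp (-1) :: 'a fps) \<noteq> 0"
    by (metis fps_zero_nth)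
  then show ?thesis
    by (simp add: pq_poly_bernoulli_def pq_polylog_compose_divide)
qed

text \<open>With \<open>M\<close> the series of moments, \<open>exp (-x t) M(1 - exp (-t))\<close>
  is \<open>exp (x t) M(-(exp t - 1))\<close> taken at \<open>-t\<close>. The latter is the Stirling
  transform of \<open>(-1)^m m! c_m\<close>, where \<open>c_m\<close> is the moment; the reflection
  adds \<open>(-1)^n\<close>.\<close>

lemma pq_poly_bernoulli_eq_sum_moment:
  fixes x :: "'a::real_normed_field"
  shows "pq_poly_bernoulli k p q n x =
           (\<Sum>m=0..n. (-1) ^ (n - m) * fact m * weighted_stirling2 n m x * pq_moment k p q m)"
proof -
  let ?M = "Abs_fps (pq_moment k p q) :: 'a fps"
  have subst: "(- fps_X oo (fps_exp 1 - 1)) oo (- fps_X) = (1 - fps_exp (-1) :: 'a fps)"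
    by (simp add: fps_compose_uminus fps_compose_sub_distrib)
  have "(fps_exp x * (?M oo (- fps_X) oo (fps_exp 1 - 1))) oo (- fps_X) =
      (?M oo ((- fps_X oo (fps_exp 1 - 1)) oo (- fps_X))) * fps_exp (- x)"
    by (simp add: fps_compose_mult_distrib fps_compose_assoc[symmetric] mult.commute)
  then have "pq_poly_bernoulli k p q n x =
      egf_coeff ((fps_exp x * (?M oo (- fps_X) oo (fps_exp 1 - 1))) oo (- fps_X)) n"
    by (simp only: subst pq_poly_bernoulli_eq_egf_coeff)
  also have "\<dots> = (-1) ^ n * (\<Sum>m=0..n. weighted_stirling2 n m x * egf_coeff (?M oo (- fps_X)) m)"
    unfolding weighted_stirling2_transform by (rule egf_coeff_compose_uminus)
  also have "\<dots> = (\<Sum>m=0..n. (-1) ^ (n - m) * fact m * weighted_stirling2 n m x * pq_moment k p q m)"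
    unfolding sum_distrib_left
    by (intro sum.cong refl)
      (simp add: fps_compose_uminus' egf_coeff_def minus_one_power_iff)
  finally show ?thesis .
qed

text \<open>The substitution \<open>t \<mapsto> -ln (1 - t)\<close> undoes
  \<open>1 - exp (-t)\<close> and turns \<open>exp (-y t)\<close> into \<open>(1 - t)^y\<close>,
  which the weight factor \<open>(1 - t)^(-y)\<close> cancels. Only the series of moments
  remains.\<close>

lemma pq_moment_eq_sum_bernoulli:
  fixes y :: "'a::real_normed_field"
  shows "fact m * pq_moment k p q m =
           (\<Sum>l=0..m. weighted_stirling1 m l y * pq_poly_bernoulli k p q l y)"
proof -
  let ?M = "Abs_fps (pq_moment k p q) :: 'a fps"
  let ?L = "- (fps_ln 1 oo (- fps_X)) :: 'a fps"
  have subst: "(1 - fps_exp (-1)) oo ?L = fps_X"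
    by (simp add: fps_compose_sub_distrib fps_exp_compose_neg_ln fps_binomial_1 fps_compose_add_distrib)
  have "(?M oo (1 - fps_exp (-1)) oo ?L) = ?M oo ((1 - fps_exp (-1)) oo ?L)"
    by (rule fps_compose_assoc[symmetric]) simp_all
  then have M: "(?M oo (1 - fps_exp (-1)) oo ?L) = ?M"
    unfolding subst by simp
  have "((?M oo (1 - fps_exp (-1))) * fps_exp (-y)) oo ?L = ?M * (fps_binomial y oo (- fps_X))"
    by (simp only: M fps_compose_mult_distrib fps_exp_compose_neg_ln minus_minus
        fps_neg_nth fps_compose_nth_0 fps_ln_0 minus_zero)
  then have "(\<Sum>l=0..m. weighted_stirling1 m l y * pq_poly_bernoulli k p q l y) =
      egf_coeff (?M * (fps_binomial y * fps_binomial (-y) oo (- fps_X))) m"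
    unfolding pq_poly_bernoulli_eq_egf_coeff weighted_stirling1_transform
    by (simp add: fps_compose_mult_distrib mult_ac)
  also have "\<dots> = egf_coeff ?M m"
    by (simp add: fps_binomial_add_mult[symmetric])
  finally show ?thesis by (simp add: egf_coeff_def)
qed

text \<open>Inserts an inversion formula into an expansion: zeros beyond the diagonal make the inner
  range uniform, so the sums can be swapped. The factor \<open>d\<close> holds the normalization of
  the inversion: 1, \<open>(-1)^m\<close> or \<open>1 / m!\<close>.\<close>

lemma sum_triangle_extend:
  fixes f :: "nat \<Rightarrow> 'b::comm_semiring_0"
  assumes "\<And>m. m \<le> n \<Longrightarrow> c m = d m * (\<Sum>l=0..m. S m l * g l)"
    and "\<And>m l. m < l \<Longrightarrow> S m l = 0"
  shows "(\<Sum>m=0..n. f m * c m) = (\<Sum>l=0..n. \<Sum>m=0..n. f m * d m * S m l * g l)"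
proof -
  have "(\<Sum>m=0..n. f m * c m) = (\<Sum>m=0..n. \<Sum>l=0..n. f m * d m * S m l * g l)"
  proof (rule sum.cong[OF refl])
    fix m assume m: "m \<in> {0..n}"
    then have "(\<Sum>l=0..m. S m l * g l) = (\<Sum>l=0..n. S m l * g l)"
      using assms(2) by (intro sum.mono_neutral_left) auto
    then show "f m * c m = (\<Sum>l=0..n. f m * d m * S m l * g l)"
      using assms(1)[of m] m by (simp add: mult.assoc flip: sum_distrib_left)
  qed
  also have "\<dots> = (\<Sum>l=0..n. \<Sum>m=0..n. f m * d m * S m l * g l)"
    by (rule sum.swap)
  finally show ?thesis .
qed

theorem theorem14:
  fixes p q :: real and k n :: nat and x y :: "'a::real_normed_field"
  assumes "0 < q" and "q < p" and "p \<le> 1" and "k > 0"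
  shows "pq_poly_bernoulli k p q n x =
           (\<Sum>l=0..n. \<Sum>m=0..n. (-1) ^ (n - m) * fact m * weighted_stirling2 n m x
              * weighted_stirling2 m l y * pq_poly_cauchy k p q l y) \<and>
         pq_poly_bernoulli k p q n x =
           (\<Sum>l=0..n. \<Sum>m=0..n. (-1) ^ n * fact m * weighted_stirling2 n m x
              * weighted_stirling2 m l (-y) * pq_poly_cauchy_hat k p q l y) \<and>
         pq_poly_cauchy k p q n x =
           (\<Sum>l=0..n. \<Sum>m=0..n. (-1) ^ (n - m) / fact m * weighted_stirling1 n m x
              * weighted_stirling1 m l y * pq_poly_bernoulli k p q l y) \<and>
         pq_poly_cauchy_hat k p q n x =
           (\<Sum>l=0..n. \<Sum>m=0..n. (-1) ^ n / fact m * weighted_stirling1 n m (-x)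
              * weighted_stirling1 m l y * pq_poly_bernoulli k p q l y)"
proof (intro conjI)
  note [simp] = weighted_stirling1_eq_0 weighted_stirling2_eq_0
  have sign: "(-1 :: 'a) ^ m * (-1) ^ (n - m) = (-1) ^ n" if "m \<le> n" for m
    using that by (simp add: power_add[symmetric])
  show "pq_poly_bernoulli k p q n x =
      (\<Sum>l=0..n. \<Sum>m=0..n. (-1) ^ (n - m) * fact m * weighted_stirling2 n m x
         * weighted_stirling2 m l y * pq_poly_cauchy k p q l y)"
    unfolding pq_poly_bernoulli_eq_sum_moment
    by (subst sum_triangle_extend[where d = "\<lambda>_. 1"])
      (auto intro: pq_moment_eq_sum_cauchy[OF assms(1,2)])
  \<comment> \<open>Multiplying the inversion by \<open>(-1)^m\<close> isolates the moment; this
    sign later merges with \<open>(-1)^(n - m)\<close> into \<open>(-1)^n\<close>.\<close>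
  have "pq_moment k p q m = (-1) ^ m *
      (\<Sum>l=0..m. weighted_stirling2 m l (-y) * pq_poly_cauchy_hat k p q l y)" for m
    by (simp add: pq_moment_eq_sum_cauchy_hat[OF assms(1,2), symmetric] mult.assoc[symmetric]
        power_mult_distrib[symmetric])
  then have "pq_poly_bernoulli k p q n x =
      (\<Sum>l=0..n. \<Sum>m=0..n. (-1) ^ (n - m) * fact m * weighted_stirling2 n m x * (-1) ^ m
         * weighted_stirling2 m l (-y) * pq_poly_cauchy_hat k p q l y)"
    unfolding pq_poly_bernoulli_eq_sum_moment by (intro sum_triangle_extend) auto
  also have "\<dots> = (\<Sum>l=0..n. \<Sum>m=0..n. (-1) ^ n * fact m * weighted_stirling2 n m x
         * weighted_stirling2 m l (-y) * pq_poly_cauchy_hat k p q l y)"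
    by (intro sum.cong refl) (simp add: sign mult_ac)
  finally show "pq_poly_bernoulli k p q n x =
      (\<Sum>l=0..n. \<Sum>m=0..n. (-1) ^ n * fact m * weighted_stirling2 n m x
         * weighted_stirling2 m l (-y) * pq_poly_cauchy_hat k p q l y)" .
  have moment: "pq_moment k p q m = 1 / fact m *
      (\<Sum>l=0..m. weighted_stirling1 m l y * pq_poly_bernoulli k p q l y)" for m
    by (simp add: pq_moment_eq_sum_bernoulli[symmetric])
  have "pq_poly_cauchy k p q n x =
      (\<Sum>l=0..n. \<Sum>m=0..n. (-1) ^ (n - m) * weighted_stirling1 n m x * (1 / fact m)
         * weighted_stirling1 m l y * pq_poly_bernoulli k p q l y)"
    unfolding pq_poly_cauchy_eq_sum_moment[OF assms(1,2)]
    by (intro sum_triangle_extend moment) simp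
  then show "pq_poly_cauchy k p q n x =
      (\<Sum>l=0..n. \<Sum>m=0..n. (-1) ^ (n - m) / fact m * weighted_stirling1 n m x
         * weighted_stirling1 m l y * pq_poly_bernoulli k p q l y)"
    by simp
  have "pq_poly_cauchy_hat k p q n x =
      (\<Sum>l=0..n. \<Sum>m=0..n. (-1) ^ n * weighted_stirling1 n m (-x) * (1 / fact m)
         * weighted_stirling1 m l y * pq_poly_bernoulli k p q l y)"
    unfolding pq_poly_cauchy_hat_eq_sum_moment[OF assms(1,2)]
    by (intro sum_triangle_extend moment) simp
  then show "pq_poly_cauchy_hat k p q n x =
      (\<Sum>l=0..n. \<Sum>m=0..n. (-1) ^ n / fact m * weighted_stirling1 n m (-x)
         * weighted_stirling1 m l y * pq_poly_bernoulli k p q l y)"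
    by simp
qed

end
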